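(* Let $(X,d)$ be a bead space and let $F\colon X\to 2^{X}$ be a mapping. Assume that $(x_n)_{n\in\mathbb{N}}$ is a regular sequence in $X$, $x\in c((x_n)_{n\in\mathbb{N}})$, $y_n\in F(x_n)$ ($n\in\mathbb{N}$) are such that $\lim_{n\to\infty}d(y_n,x_n)=0$, and $$\limsup_{n\to\infty} d(F(x),y_n)\le\limsup_{n\to\infty} d(x,x_n).$$ If $F(x)$ is compact, then $x\in F(x)$.
   Context: $2^{X}$ is the family of all subsets of $X$; a mapping $F\colon X\to 2^{X}$ is understood to satisfy $X\neq\emptyset$ and $F(x)\neq\emptyset$ for all $x\in X$. For a nonempty set $A$, $d(A,y)=d(y,A)=\inf_{a\in A}d(a,y)$. $B(x,r)$ denotes the ball with center $x$ and radius $r$, $B(x,r)=\{y\in X\colon d(x,y)<r\}$. Bead space: a metric space $(X,d)$ such that for every $r>0$, $\beta>0$ there exists a $\delta>0$ such that for each $x,y\in X$ with $d(x,y)\ge\beta$ there exists a $z\in X$ with $B(x,r+\delta)\cap B(y,r+\delta)\subset B(z,r-\delta)$. Let $(x_n)_{n\in\mathbb{N}}$ be a bounded sequence in $X$ and let $\mathcal{A}=\{A_n\colon n\in\mathbb{N}\}$ with $A_n=\{x_k\colon k\ge n\}$. Its (asymptotic) radius is $r((x_n)_{n\in\mathbb{N}})=\inf\{t\in(0,\infty)\colon \text{there exist } A\in\mathcal{A},\ z\in X \text{ with } A\subset B(z,t)\}$. Its (asymptotic) centre $c((x_n)_{n\in\mathbb{N}})$ is the set of all $x\in X$ such that $\inf\{t\in(0,\infty)\colon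 \text{there exists } A\in\mathcal{A} \text{ with } A\subset B(x,t)\}=r((x_n)_{n\in\mathbb{N}})$. A bounded sequence $(x_n)_{n\in\mathbb{N}}$ is regular if $r((x_{k_n})_{n\in\mathbb{N}})=r((x_n)_{n\in\mathbb{N}})$ for each of its subsequences $(x_{k_n})_{n\in\mathbb{N}}$. *)

theory Defs
  imports "HOL-Analysis.Analysis"
begin

text \<open>The metric space \<open>X\<close> is the universe of a type of class \<open>metric_space\<close>.\<close>

definition bead_space :: "'a::metric_space itself \<Rightarrow> bool" where
  "bead_space _ \<longleftrightarrow>
     (\<forall>r>0. \<forall>\<beta>>0. \<exists>\<delta>>0. \<forall>x y :: 'a. dist x y \<ge> \<beta> \<longrightarrow>
        (\<exists>z. ball x (r + \<delta>) \<inter> ball y (r + \<delta>) \<subseteq> ball z (r - \<delta>)))"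

definition tails :: "(nat \<Rightarrow> 'a) \<Rightarrow> 'a set set" where
  "tails xs = {{xs k |k. k \<ge> n} |n. True}"

text \<open>For a bounded sequence, the sets of reals in the next two definitions are nonempty and
  bounded below, so that \<open>Inf\<close> is the true infimum.  For other sequences \<open>Inf\<close> may have no
  mathematical meaning.\<close>

definition asymptotic_radius :: "(nat \<Rightarrow> 'a::metric_space) \<Rightarrow> real" where
  "asymptotic_radius xs = Inf {t. 0 < t \<and> (\<exists>A\<in>tails xs. \<exists>z. A \<subseteq> ball z t)}"

definition asymptotic_centre :: "(nat \<Rightarrow> 'a::metric_space) \<Rightarrow> 'a set" where
  "asymptotic_centre xs =
     {x. Inf {t. 0 < t \<and> (\<exists>A\<in>tails xs. A \<subseteq> ball x t)} = asymptotic_radius xs}"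

definition regular_sequence :: "(nat \<Rightarrow> 'a::metric_space) \<Rightarrow> bool" where
  "regular_sequence xs \<longleftrightarrow> bounded (range xs) \<and>
     (\<forall>k. strict_mono k \<longrightarrow> asymptotic_radius (xs \<circ> k) = asymptotic_radius xs)"

end

theory Submission
  imports Defs
begin

text \<open>
  Let \<open>r\<close> be the asymptotic radius of the sequence.  Since \<open>ys n\<close> is asymptotically the same point
  as \<open>xs n\<close>, the hypothesis on the upper limits says that the compact set \<open>F x\<close> comes, in the
  limit, as close to \<open>xs n\<close> as the centre \<open>x\<close> does, that is, within every distance larger than
  \<open>r\<close>.  The point of \<open>F x\<close> that achieves this may depend on \<open>n\<close>, but compactness yields one
  point \<open>z\<close> of \<open>F x\<close> that serves for a whole subsequence (\<open>compact_limsup_infdist_subsequence\<close>).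

  That subsequence now lies eventually in every ball of radius larger than \<open>r\<close> around \<open>x\<close>, and
  likewise around \<open>z\<close>.  If \<open>x \<noteq> z\<close> and \<open>r > 0\<close>, the bead property encloses the intersection of two
  such balls in one ball of radius smaller than \<open>r\<close>, so passing to the subsequence would lower the
  asymptotic radius, against regularity (\<open>bead_space_asymptotic_centre_unique\<close>).  Hence
  \<open>x = z \<in> F x\<close>.
\<close>

lemma asymptotic_radius_le:
  assumes "0 < t" and "\<forall>\<^sub>F n in sequentially. dist z (xs n) < t"
  shows "asymptotic_radius xs \<le> t"
  unfolding asymptotic_radius_def
proof (rule cInf_lower)
  obtain n where "\<forall>k\<ge>n. dist z (xs k) < t"
    using assms(2) by (auto simp: eventually_sequentially)
  then have "{xs k |k. k \<ge> n} \<subseteq> ball z t" by auto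
  moreover have "{xs k |k. k \<ge> n} \<in> tails xs" by (auto simp: tails_def)
  ultimately show "t \<in> {t. 0 < t \<and> (\<exists>A\<in>tails xs. \<exists>z. A \<subseteq> ball z t)}"
    using \<open>0 < t\<close> by blast
  show "bdd_below {t. 0 < t \<and> (\<exists>A\<in>tails xs. \<exists>z. A \<subseteq> ball z t)}"
    by (rule bdd_belowI[of _ 0]) auto
qed

lemma asymptotic_centre_eventually_dist_less:
  assumes "bounded (range xs)" and "x \<in> asymptotic_centre xs"
    and "asymptotic_radius xs < t"
  shows "\<forall>\<^sub>F n in sequentially. dist x (xs n) < t"
proof -
  let ?S = "{t. 0 < t \<and> (\<exists>A\<in>tails xs. A \<subseteq> ball x t)}"
  \<comment> \<open>Boundedness makes \<open>?S\<close> nonempty, so that its \<open>Inf\<close> is approached by elements of \<open>?S\<close>.\<close>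
  obtain e where e: "\<forall>y\<in>range xs. dist x y \<le> e"
    using assms(1) bounded_any_center[of "range xs" x] by blast
  then have "0 \<le> e" using order_trans[OF zero_le_dist] by blast
  moreover have "{xs k |k. k \<ge> 0} \<subseteq> ball x (e + 1)"
  proof
    fix y assume "y \<in> {xs k |k. k \<ge> 0}"
    then have "dist x y \<le> e" using e by blast
    then show "y \<in> ball x (e + 1)" by simp
  qed
  moreover have "{xs k |k. k \<ge> 0} \<in> tails xs" unfolding tails_def by blast
  ultimately have "e + 1 \<in> ?S" by (auto intro!: bexI[of _ "{xs k |k. k \<ge> 0}"])
  moreover have "Inf ?S < t"
    using assms(2,3) by (simp add: asymptotic_centre_def)
  ultimately obtain s where "s \<in> ?S" "s < t"
    using cInf_lessD[of ?S t] by blast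
  then obtain n where "{xs k |k. k \<ge> n} \<subseteq> ball x s"
    by (auto simp: tails_def)
  then have "\<forall>k\<ge>n. dist x (xs k) < t"
    using \<open>s < t\<close> by fastforce
  then show ?thesis by (auto simp: eventually_sequentially)
qed

text \<open>Nearest points of \<open>K\<close> to the \<open>ys n\<close> have a convergent subsequence; its limit is as close
  to the \<open>ys n\<close> along that subsequence as the nearest points themselves, up to an error that
  tends to zero.\<close>

lemma compact_limsup_infdist_subsequence:
  fixes K :: "'a::metric_space set"
  assumes "compact K" "K \<noteq> {}"
    and "limsup (\<lambda>n. ereal (infdist (ys n) K)) \<le> ereal r"
  obtains z k where "z \<in> K" "strict_mono (k :: nat \<Rightarrow> nat)"
    "\<And>t. r < t \<Longrightarrow> \<forall>\<^sub>F n in sequentially. dist z (ys (k n)) < t"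
proof -
  have "\<exists>p\<in>K. infdist (ys n) K = dist (ys n) p" for n
    by (rule setdist_attains_inf[OF assms(1,2), of "{ys n}"])
      (auto simp: infdist_eq_setdist dist_commute)
  then obtain p where pK: "\<And>n. p n \<in> K" and p: "\<And>n. infdist (ys n) K = dist (ys n) (p n)"
    by metis
  obtain z k where z: "z \<in> K" and k: "strict_mono (k :: nat \<Rightarrow> nat)" and lim: "(p \<circ> k) \<longlonglongrightarrow> z"
    using \<open>compact K\<close> pK unfolding compact_def by metis
  show thesis
  proof (rule that[OF z k])
    fix t assume "r < t"
    define e where "e = (t - r) / 2"
    have "0 < e" and t: "t = (r + e) + e" using \<open>r < t\<close> by (auto simp: e_def)
    have "limsup (\<lambda>n. ereal (infdist (ys n) K)) < ereal (r + e)"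
      by (rule le_less_trans[OF assms(3)]) (simp add: \<open>0 < e\<close>)
    then have "\<forall>\<^sub>F n in sequentially. ereal (infdist (ys n) K) < ereal (r + e)"
      by (rule Limsup_lessD)
    then have "\<forall>\<^sub>F n in sequentially. dist (ys n) (p n) < r + e"
      by (simp add: p)
    then have "\<forall>\<^sub>F n in sequentially. dist (ys (k n)) (p (k n)) < r + e"
      by (rule eventually_subseq[OF k])
    moreover have "\<forall>\<^sub>F n in sequentially. dist (p (k n)) z < e"
      using tendstoD[OF lim \<open>0 < e\<close>] by simp
    ultimately show "\<forall>\<^sub>F n in sequentially. dist z (ys (k n)) < t"
    proof eventually_elim
      case (elim n)
      have "dist z (ys (k n)) \<le> dist (ys (k n)) (p (k n)) + dist (p (k n)) z"
        using dist_triangle[of z "ys (k n)" "p (k n)"] by (simp add: dist_commute)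
      with elim t show ?case by linarith
    qed
  qed
qed

text \<open>Two distinct points \<open>x\<close> and \<open>z\<close> cannot both be centres of the sequence: the bead property
  would confine its tails to a ball of radius \<open>r - \<delta>\<close>.  When the radius \<open>r\<close> is not positive the
  bead property says nothing, but then the sequence converges to both points.\<close>

lemma bead_space_asymptotic_centre_unique:
  fixes x z :: "'a::metric_space"
  assumes "bead_space TYPE('a)"
    and x: "\<And>t. asymptotic_radius xs < t \<Longrightarrow> \<forall>\<^sub>F n in sequentially. dist x (xs n) < t"
    and z: "\<And>t. asymptotic_radius xs < t \<Longrightarrow> \<forall>\<^sub>F n in sequentially. dist z (xs n) < t"
  shows "x = z"
proof (rule ccontr)
  assume "x \<noteq> z"
  let ?r = "asymptotic_radius xs"
  have both: "\<forall>\<^sub>F n in sequentially. dist x (xs n) < t \<and> dist z (xs n) < t" if "?r < t" for t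
    using x[OF that] z[OF that] by (rule eventually_conj)
  show False
  proof (cases "0 < ?r")
    case True
    then obtain \<delta> where "0 < \<delta>" and
      bead: "\<And>u v :: 'a. dist x z \<le> dist u v \<Longrightarrow>
        \<exists>w. ball u (?r + \<delta>) \<inter> ball v (?r + \<delta>) \<subseteq> ball w (?r - \<delta>)"
      using \<open>bead_space TYPE('a)\<close> \<open>x \<noteq> z\<close> unfolding bead_space_def by (metis zero_less_dist_iff)
    then obtain w where "ball x (?r + \<delta>) \<inter> ball z (?r + \<delta>) \<subseteq> ball w (?r - \<delta>)"
      by blast
    with both[of "?r + \<delta>"] \<open>0 < \<delta>\<close>
    have w: "\<forall>\<^sub>F n in sequentially. dist w (xs n) < ?r - \<delta>"
      by (auto simp: subset_iff elim!: eventually_mono)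
    \<comment> \<open>\<open>?r - \<delta>\<close> is positive because a ball with that radius contains some \<open>xs n\<close>.\<close>
    then obtain n where "dist w (xs n) < ?r - \<delta>"
      using eventually_happens'[OF sequentially_bot] by blast
    then have "0 < ?r - \<delta>" by (rule le_less_trans[OF zero_le_dist])
    from asymptotic_radius_le[OF this w] \<open>0 < \<delta>\<close> show False by simp
  next
    case False
    moreover have "0 < dist x z / 2" using \<open>x \<noteq> z\<close> by simp
    ultimately have "?r < dist x z / 2" by linarith
    then obtain n where "dist x (xs n) < dist x z / 2 \<and> dist z (xs n) < dist x z / 2"
      using both eventually_happens'[OF sequentially_bot] by blast
    then show False using dist_triangle2[of x z "xs n"] by linarith
  qed
qed

theorem theorem2p3:
  fixes F :: "'a::metric_space \<Rightarrow> 'a set"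
    and xs ys :: "nat \<Rightarrow> 'a"
    and x :: 'a
  assumes "bead_space TYPE('a)"
    and "\<And>u. F u \<noteq> {}"
    and "regular_sequence xs"
    and "x \<in> asymptotic_centre xs"
    and "\<And>n. ys n \<in> F (xs n)"
    and "(\<lambda>n. dist (ys n) (xs n)) \<longlonglongrightarrow> 0"
    and "limsup (\<lambda>n. ereal (infdist (ys n) (F x))) \<le> limsup (\<lambda>n. ereal (dist x (xs n)))"
    and "compact (F x)"
  shows "x \<in> F x"
proof -
  let ?r = "asymptotic_radius xs"
  have bdd: "bounded (range xs)"
    and reg: "\<And>k. strict_mono k \<Longrightarrow> asymptotic_radius (xs \<circ> k) = ?r"
    using \<open>regular_sequence xs\<close> by (auto simp: regular_sequence_def)
  note near_x = asymptotic_centre_eventually_dist_less[OF bdd \<open>x \<in> asymptotic_centre xs\<close>]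
  have "limsup (\<lambda>n. ereal (dist x (xs n))) \<le> ereal ?r"
  proof (rule ereal_le_epsilon2)
    fix e :: real assume "0 < e"
    then have "\<forall>\<^sub>F n in sequentially. ereal (dist x (xs n)) \<le> ereal (?r + e)"
      using near_x[of "?r + e"] by (auto elim!: eventually_mono)
    then show "limsup (\<lambda>n. ereal (dist x (xs n))) \<le> ereal ?r + ereal e"
      by (simp add: Limsup_bounded)
  qed
  with assms(7) have "limsup (\<lambda>n. ereal (infdist (ys n) (F x))) \<le> ereal ?r"
    by (rule order_trans)
  then obtain z k where "z \<in> F x" and k: "strict_mono (k :: nat \<Rightarrow> nat)"
    and near_z: "\<And>t. ?r < t \<Longrightarrow> \<forall>\<^sub>F n in sequentially. dist z (ys (k n)) < t"
    using compact_limsup_infdist_subsequence[OF \<open>compact (F x)\<close> assms(2)] by blast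
  have "x = z"
  proof (rule bead_space_asymptotic_centre_unique[OF assms(1), of "xs \<circ> k"])
    fix t assume "asymptotic_radius (xs \<circ> k) < t"
    then have "?r < t" by (simp add: reg[OF k])
    show "\<forall>\<^sub>F n in sequentially. dist x ((xs \<circ> k) n) < t"
      using eventually_subseq[OF k near_x[OF \<open>?r < t\<close>]] by simp
    define e where "e = (t - ?r) / 2"
    have "0 < e" and t: "t = (?r + e) + e" using \<open>?r < t\<close> by (auto simp: e_def)
    have "\<forall>\<^sub>F n in sequentially. dist (ys n) (xs n) < e"
      using order_tendstoD(2)[OF assms(6) \<open>0 < e\<close>] .
    then have "\<forall>\<^sub>F n in sequentially. dist (ys (k n)) (xs (k n)) < e"
      by (rule eventually_subseq[OF k])
    moreover have "\<forall>\<^sub>F n in sequentially. dist z (ys (k n)) < ?r + e"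
      using near_z \<open>0 < e\<close> by simp
    ultimately show "\<forall>\<^sub>F n in sequentially. dist z ((xs \<circ> k) n) < t"
    proof eventually_elim
      case (elim n)
      then show ?case
        using dist_triangle[of z "xs (k n)" "ys (k n)"] t by simp
    qed
  qed
  with \<open>z \<in> F x\<close> show ?thesis by simp
qed

end
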